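(* Let $f$ be a conformal map of the unit disk $\mathbb{D}$ onto the interior of an $(n+1)$-gon, and let $B_1,B_2$ be the finite Blaschke products without common zeros, of respective degrees $d_1,d_2$ with $d_1+d_2=n$, such that $$\frac{f''}{f'}(z)=\frac{2B_1(z)/B_2(z)}{1-zB_1(z)/B_2(z)},\qquad z\in\mathbb{D}.$$ Then $d_2$ is equal to the number of concave vertices of the polygon, while $d_1+1$ is equal to the number of convex vertices.
   Context: $\mathbb{D}=\{|z|<1\}$. A Schwarz-Christoffel mapping onto the interior of an $(n+1)$-gon is a (analytic) conformal map $f$ of $\mathbb{D}$ onto a domain whose boundary consists of finitely many line segments, rays or lines, with $n+1$ vertices (vertices at infinity are allowed). It satisfies the Schwarz-Christoffel formula $$\frac{f''}{f'}(z)=-2\sum_{k=1}^{n+1}\frac{\beta_k}{z-z_k},\qquad \sum_{k=1}^{n+1}\beta_k=1,$$ where the distinct points $z_k\in\partial\mathbb{D}$ are the pre-vertices (the preimages of the vertices) and $2\pi\beta_k\neq 0$ are the exterior angles, $2\pi\beta_k=\pi-\alpha_k$, with $\alpha_k$ the interior angle at the vertex $f(z_k)$. At a vertex at infinity, $\alpha_k$ is by definition minus the angle between the (continuations of the) relevant sides at a finite point. The vertex $f(z_k)$ is convex if $\beta_k>0$ and concave if $\beta_k<0$. A finite Blaschke product of degree $d$ is a function $c\prod_{k=1}^{d}\frac{z-a_k}{1-\overline{a_k}z}$ with $|c|=1$ and all $|a_k|<1$ (a unimodular constant if $d=0$). It is known that for every such $f$ the function $f''/f'$ has the stated representation with finite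 Blaschke products $B_1,B_2$ without common zeros and $d_1+d_2=n$. *)

theory Defs
  imports "HOL-Complex_Analysis.Complex_Analysis"
begin

text \<open>The boundary is a finite union of nondegenerate segments, closed rays and lines.\<close>

definition polygonal_boundary :: "complex set \<Rightarrow> bool" where
  "polygonal_boundary \<Omega> \<longleftrightarrow>
     (\<exists>S. finite S \<and> frontier \<Omega> = \<Union>S \<and>
        (\<forall>s\<in>S. (\<exists>a b. a \<noteq> b \<and> s = closed_segment a b) \<or>
               (\<exists>a u. u \<noteq> 0 \<and> s = {a + t *\<^sub>R u |t. t \<ge> 0}) \<or>
               (\<exists>a u. u \<noteq> 0 \<and> s = range (\<lambda>t::real. a + t *\<^sub>R u))))"

text \<open>
  The boundary values of \<open>f\<close> along the arc \<open>cis t\<close>, \<open>a < t < b\<close>, run along the line through \<open>p\<close>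
  strictly monotonically in the unit direction \<open>v\<close> as \<open>t\<close> increases.
\<close>

definition runs_along :: "(complex \<Rightarrow> complex) \<Rightarrow> real \<Rightarrow> real \<Rightarrow> complex \<Rightarrow> complex \<Rightarrow> bool" where
  "runs_along f a b p v \<longleftrightarrow> norm v = 1 \<and>
     (\<exists>s::real \<Rightarrow> real. strict_mono_on {a<..<b} s \<and>
        (\<forall>t\<in>{a<..<b}. (f \<longlongrightarrow> p + s t *\<^sub>R v) (at (cis t) within ball 0 1)))"

text \<open>
  \<open>\<alpha>\<close> is the interior angle of the image of \<open>f\<close> at the boundary point (prime end) belonging
  to \<open>\<zeta>\<close> on the unit circle. For an injective holomorphic \<open>f\<close>, the image lies to the left of its
  positively oriented boundary, which arrives in direction \<open>v\<close> and leaves in direction \<open>w\<close>.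

  At a finite point, turning counterclockwise through the interior from \<open>w\<close> leads to \<open>-v\<close>, so
  \<open>cis \<alpha> = -v/w\<close> with \<open>0 < \<alpha> \<le> 2 * pi\<close>; a slit end has \<open>\<alpha> = 2 * pi\<close>, and \<open>\<alpha> = pi\<close> says that
  the point lies in the interior of a side.

  At infinity, turning counterclockwise through the interior from \<open>v\<close> leads to \<open>-w\<close>, by an
  angle in the interval from \<open>0\<close> to \<open>2 * pi\<close>, and \<open>\<alpha>\<close> is minus this angle; again
  \<open>cis \<alpha> = -v/w\<close>. If \<open>w = -v\<close>, this leaves the values \<open>0\<close> (the end of a strip, the outgoing line
  being strictly to the left of the incoming one) and \<open>-2 * pi\<close> (the outside of a half-strip
  or of a ray).
\<close>

definition interior_angle :: "(complex \<Rightarrow> complex) \<Rightarrow> complex \<Rightarrow> real \<Rightarrow> bool" where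
  "interior_angle f \<zeta> \<alpha> \<longleftrightarrow>
     (\<exists>\<tau> \<epsilon> p q v w. \<zeta> = cis \<tau> \<and> \<epsilon> > 0 \<and>
        runs_along f (\<tau> - \<epsilon>) \<tau> p v \<and> runs_along f \<tau> (\<tau> + \<epsilon>) q w \<and>
        cis \<alpha> = - v / w \<and>
        ((\<exists>l. (f \<longlongrightarrow> l) (at \<zeta> within ball 0 1)) \<and> 0 < \<alpha> \<and> \<alpha> \<le> 2 * pi \<or>
         filterlim f at_infinity (at \<zeta> within ball 0 1) \<and> - 2 * pi \<le> \<alpha> \<and> \<alpha> \<le> 0 \<and>
           (w = - v \<longrightarrow> (\<alpha> = 0 \<longleftrightarrow> Im ((q - p) / v) > 0))))"

text \<open>
  \<open>f\<close> maps the unit disk conformally onto the interior of an \<open>(n+1)\<close>-gon with pre-vertices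
  \<open>z 1, \<dots>, z (n+1)\<close> and interior angles \<open>\<alpha> 1, \<dots>, \<alpha> (n+1)\<close>. Vertices are counted as prime ends,
  i.e. by their pre-vertices. The pre-vertices are exactly the points of the circle at which the
  boundary does not go straight on through a finite point; in particular all \<open>\<alpha> k \<noteq> pi\<close>.
\<close>

definition polygon_map ::
  "(complex \<Rightarrow> complex) \<Rightarrow> nat \<Rightarrow> (nat \<Rightarrow> complex) \<Rightarrow> (nat \<Rightarrow> real) \<Rightarrow> bool" where
  "polygon_map f n z \<alpha> \<longleftrightarrow>
     f holomorphic_on ball 0 1 \<and> inj_on f (ball 0 1) \<and>
     polygonal_boundary (f ` ball 0 1) \<and>
     inj_on z {1..n+1} \<and>
     z ` {1..n+1} = {\<zeta> \<in> sphere 0 1. \<not> interior_angle f \<zeta> pi} \<and>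
     (\<forall>k\<in>{1..n+1}. interior_angle f (z k) (\<alpha> k))"

definition finite_Blaschke :: "nat \<Rightarrow> (complex \<Rightarrow> complex) \<Rightarrow> bool" where
  "finite_Blaschke d B \<longleftrightarrow>
     (\<exists>c a. norm c = 1 \<and> (\<forall>k\<in>{1..d}. norm (a k) < 1) \<and>
        (\<forall>z\<in>ball 0 1. B z = c * (\<Prod>k=1..d. (z - a k) / (1 - cnj (a k) * z))))"

end

theory Submission
  imports Defs
begin

text \<open>
  Put \<open>G(w) = 1 + w f''(w) / (2 f'(w))\<close>. The Schwarz-Christoffel formula gives
  \<open>G(w) = (\<Sum>k. \<beta> k * u k w)\<close> with \<open>u k w = z k / (z k - w)\<close>, and the representation gives
  \<open>G = B2 / D\<close> with \<open>D(w) = B2(w) - w B1(w)\<close>. Computing the kernel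
  \<open>D(w) (G(w) + cnj (G(v)) - 1) cnj (D(v)) / (1 - w cnj v)\<close> in both ways yields
  \<open>D(w) (\<Sum>k. \<beta> k * u k w * cnj (u k v)) cnj (D(v))
     = (1 - w B1(w) cnj (v B1(v))) / (1 - w cnj v) - (1 - B2(w) cnj (B2(v))) / (1 - w cnj v)\<close>.
  A Blaschke product of degree \<open>d\<close> has a Pick kernel that is a sum of \<open>d\<close> squares, so the right
  side is a difference of \<open>d1 + 1\<close> and \<open>d2\<close> squares. The left side is nondegenerate on \<open>n + 1\<close>
  points (Cauchy matrix), and Sylvester's law of inertia gives the claim, as
  \<open>(d1 + 1) + d2 = n + 1\<close>.
\<close>

section \<open>Linear systems, Cauchy matrices and the law of inertia\<close>

lemma underdetermined_system:
  fixes A :: "'j \<Rightarrow> 'i \<Rightarrow> 'a::field"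
  assumes "finite J" "finite I" "card J < card I"
  shows "\<exists>c. (\<exists>i\<in>I. c i \<noteq> 0) \<and> (\<forall>j\<in>J. (\<Sum>i\<in>I. c i * A j i) = 0)"
  using assms
proof (induction J arbitrary: A I rule: finite_induct)
  case empty
  then have "I \<noteq> {}" by auto
  then show ?case by (intro exI[of _ "\<lambda>_. 1"]) auto
next
  case (insert j J)
  show ?case
  proof (cases "\<forall>i\<in>I. A j i = 0")
    case True
    obtain c where "\<exists>i\<in>I. c i \<noteq> 0" "\<forall>j\<in>J. (\<Sum>i\<in>I. c i * A j i) = 0"
      using insert.IH[of I A] insert.prems insert.hyps by auto
    then show ?thesis using True by (intro exI[of _ c]) auto
  next
    case False
    then obtain p where p: "p \<in> I" "A j p \<noteq> 0" by blast
    \<comment> \<open>Gaussian elimination with pivot \<open>A j p\<close>: \<open>A'\<close> is the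
      system after unknown \<open>p\<close> has been eliminated by means of equation
      \<open>j\<close>. Later \<open>c'\<close> recovers the value at \<open>p\<close> from that
      equation.\<close>
    define A' where "A' = (\<lambda>k i. A k i - A k p / A j p * A j i)"
    have "card J < card (I - {p})"
      using insert.prems insert.hyps p by auto
    then obtain c where c: "\<exists>i\<in>I-{p}. c i \<noteq> 0"
        "\<forall>k\<in>J. (\<Sum>i\<in>I-{p}. c i * A' k i) = 0"
      using insert.IH[of "I - {p}" A'] insert.prems by auto
    define s where "s = (\<Sum>i\<in>I-{p}. c i * A j i)"
    define c' where "c' = c(p := - s / A j p)"
    have split: "(\<Sum>i\<in>I. c' i * A k i) = - s / A j p * A k p + (\<Sum>i\<in>I-{p}. c i * A k i)" for k
    proof -
      have "(\<Sum>i\<in>I-{p}. c' i * A k i) = (\<Sum>i\<in>I-{p}. c i * A k i)"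
        by (intro sum.cong) (auto simp: c'_def)
      then show ?thesis
        using p insert.prems by (simp add: sum.remove[of I p] c'_def)
    qed
    have "(\<Sum>i\<in>I. c' i * A k i) = 0" if "k \<in> J" for k
    proof -
      have "0 = (\<Sum>i\<in>I-{p}. c i * A' k i)"
        using c(2) that by simp
      also have "\<dots> = (\<Sum>i\<in>I-{p}. c i * A k i - A k p / A j p * (c i * A j i))"
        by (simp add: A'_def right_diff_distrib mult_ac)
      also have "\<dots> = (\<Sum>i\<in>I-{p}. c i * A k i) - A k p / A j p * s"
        by (simp add: sum_subtractf sum_distrib_left s_def)
      finally show ?thesis by (simp add: split field_simps)
    qed
    moreover have "(\<Sum>i\<in>I. c' i * A j i) = 0"
      using p by (simp add: split s_def)
    moreover have "\<exists>i\<in>I. c' i \<noteq> 0"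
      using c(1) by (auto simp: c'_def)
    ultimately show ?thesis by blast
  qed
qed

text \<open>Clearing denominators turns the sum into a polynomial \<open>Q\<close> in
  \<open>y\<close> of degree below \<open>card I\<close>. It has at least \<open>card I\<close>
  roots, hence is zero, and evaluation at the node \<open>x i\<close> isolates
  \<open>c i\<close>.\<close>

lemma cauchy_matrix_nondegenerate:
  fixes x c :: "'i \<Rightarrow> 'a::field"
  assumes "finite I" "inj_on x I" "finite Y" "card I \<le> card Y" "Y \<inter> x ` I = {}"
    and zero: "\<And>y. y \<in> Y \<Longrightarrow> (\<Sum>i\<in>I. c i / (x i - y)) = 0"
    and "i \<in> I"
  shows "c i = 0"
proof -
  define Q where "Q = (\<Sum>i\<in>I. smult (c i) (\<Prod>j\<in>I-{i}. [:x j, -1:]))"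
  have poly_Q: "poly Q y = (\<Sum>i\<in>I. c i * (\<Prod>j\<in>I-{i}. x j - y))" for y
    by (simp add: Q_def poly_sum poly_prod)
  have roots: "poly Q y = 0" if "y \<in> Y" for y
  proof -
    have ne: "x j - y \<noteq> 0" if "j \<in> I" for j
      using assms(5) \<open>y \<in> Y\<close> that by auto
    have "poly Q y = (\<Prod>j\<in>I. x j - y) * (\<Sum>i\<in>I. c i / (x i - y))"
      unfolding poly_Q sum_distrib_left
      by (intro sum.cong) (use ne assms(1) in \<open>auto simp: prod.remove\<close>)
    then show ?thesis using zero[OF that] by simp
  qed
  have "degree Q \<le> card I - 1"
    unfolding Q_def
  proof (intro degree_sum_le)
    fix i assume "i \<in> I"
    have "degree (\<Prod>j\<in>I-{i}. [:x j, -1:]) \<le> (\<Sum>j\<in>I-{i}. degree [:x j, -1:])"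
      using degree_prod_sum_le[of "I-{i}" "\<lambda>j. [:x j, -1:]"] assms(1) by (simp add: o_def)
    then show "degree (smult (c i) (\<Prod>j\<in>I-{i}. [:x j, -1:])) \<le> card I - 1"
      using \<open>i \<in> I\<close> assms(1) by (simp add: card_Diff_singleton)
  qed (use assms in auto)
  moreover have "card I > 0" using assms by (auto simp: card_gt_0_iff)
  ultimately have "degree Q < card Y" using assms(4) by linarith
  have "Q = 0"
  proof (rule ccontr)
    assume "Q \<noteq> 0"
    have "card Y \<le> card {y. poly Q y = 0}"
      using roots \<open>Q \<noteq> 0\<close> by (intro card_mono poly_roots_finite) auto
    also have "\<dots> \<le> degree Q" by (rule card_poly_roots_bound) fact
    finally show False using \<open>degree Q < card Y\<close> by simp
  qed
  \<comment> \<open>For \<open>k\<close> other than \<open>i\<close> the product contains the factor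
    \<open>x i - x i\<close>, so only the summand of \<open>i\<close> survives.\<close>
  have "(\<Sum>k\<in>I. c k * (\<Prod>j\<in>I-{k}. x j - x i)) = c i * (\<Prod>j\<in>I-{i}. x j - x i)"
    unfolding sum.remove[OF \<open>finite I\<close> \<open>i \<in> I\<close>]
    using assms(1) \<open>i \<in> I\<close> by (auto intro!: sum.neutral bexI[of _ i])
  then have "c i * (\<Prod>j\<in>I-{i}. x j - x i) = 0"
    using poly_Q[of "x i"] \<open>Q = 0\<close> by simp
  moreover have "(\<Prod>j\<in>I-{i}. x j - x i) \<noteq> 0"
    using assms(1,2) \<open>i \<in> I\<close> by (auto simp: inj_on_def)
  ultimately show ?thesis by simp
qed

lemma sum_rank_one_kernel:
  fixes c u :: "'i \<Rightarrow> complex"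
  shows "(\<Sum>i\<in>I. \<Sum>j\<in>I. c i * cnj (c j) * (u i * cnj (u j))) = of_real ((norm (\<Sum>i\<in>I. c i * u i))\<^sup>2)"
  unfolding complex_norm_square by (simp add: sum_product mult_ac)

text \<open>One half of Sylvester's law. If \<open>I\<close> were larger, some nonzero
  \<open>c\<close> would annihilate every \<open>g q\<close> and every \<open>u k\<close> with
  positive weight. On this \<open>c\<close> the form is nonpositive by the left side of
  \<open>kernel\<close> and nonnegative by the right side, so it is zero; then \<open>c\<close>
  annihilates all \<open>u k\<close>, contrary to nondegeneracy.\<close>

lemma inertia_bound:
  fixes u :: "'k \<Rightarrow> 'i \<Rightarrow> complex" and \<beta> :: "'k \<Rightarrow> real"
  assumes "finite I" "finite K" "finite P" "finite N"
    and nonzero: "\<And>k. k \<in> K \<Longrightarrow> \<beta> k \<noteq> 0"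
    and nondegenerate: "\<And>c. (\<And>k. k \<in> K \<Longrightarrow> (\<Sum>i\<in>I. c i * u k i) = 0) \<Longrightarrow> \<forall>i\<in>I. c i = 0"
    and kernel: "\<And>i j. i \<in> I \<Longrightarrow> j \<in> I \<Longrightarrow>
      (\<Sum>k\<in>K. of_real (\<beta> k) * (u k i * cnj (u k j))) =
      (\<Sum>p\<in>P. e p i * cnj (e p j)) - (\<Sum>q\<in>N. g q i * cnj (g q j))"
  shows "card I \<le> card {k\<in>K. \<beta> k > 0} + card N"
proof (rule ccontr)
  assume contr: "\<not> ?thesis"
  define V where "V = u ` {k\<in>K. \<beta> k > 0} \<union> g ` N"
  have "finite V" using assms by (simp add: V_def)
  have "card V \<le> card (u ` {k\<in>K. \<beta> k > 0}) + card (g ` N)"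
    unfolding V_def by (rule card_Un_le)
  also have "\<dots> \<le> card {k\<in>K. \<beta> k > 0} + card N"
    using assms by (intro add_mono card_image_le) auto
  finally have "card V < card I" using contr by linarith
  then obtain c where c: "\<exists>i\<in>I. c i \<noteq> 0" "\<forall>v\<in>V. (\<Sum>i\<in>I. c i * v i) = 0"
    using underdetermined_system[of V I "\<lambda>v. v"] \<open>finite V\<close> \<open>finite I\<close> by blast
  define L where "L = (\<lambda>v. (norm (\<Sum>i\<in>I. c i * v i))\<^sup>2)"
  \<comment> \<open>Arbitrary weights \<open>b\<close> allow one identity to serve both the
    \<beta>-weighted sum and the plain sums of squares, where the weight is 1.\<close>
  have form: "(\<Sum>i\<in>I. \<Sum>j\<in>I. c i * cnj (c j) * (\<Sum>m\<in>M. b m * (h m i * cnj (h m j)))) =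
      (\<Sum>m\<in>M. b m * of_real (L (h m)))" for M :: "'m set" and b h
  proof -
    have "(\<Sum>i\<in>I. \<Sum>j\<in>I. c i * cnj (c j) * (\<Sum>m\<in>M. b m * (h m i * cnj (h m j)))) =
       (\<Sum>i\<in>I. \<Sum>m\<in>M. \<Sum>j\<in>I. b m * (c i * cnj (c j) * (h m i * cnj (h m j))))"
      unfolding sum_distrib_left by (subst sum.swap[of _ M I]) (simp add: mult_ac)
    also have "\<dots> = (\<Sum>m\<in>M. b m * of_real (L (h m)))"
      unfolding L_def sum_rank_one_kernel[symmetric] sum_distrib_left by (rule sum.swap)
    finally show ?thesis .
  qed
  have "complex_of_real (\<Sum>k\<in>K. \<beta> k * L (u k)) =
      (\<Sum>i\<in>I. \<Sum>j\<in>I. c i * cnj (c j) * (\<Sum>k\<in>K. of_real (\<beta> k) * (u k i * cnj (u k j))))"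
    by (simp add: form)
  also have "\<dots> = (\<Sum>i\<in>I. \<Sum>j\<in>I. c i * cnj (c j) * (\<Sum>p\<in>P. 1 * (e p i * cnj (e p j)))) -
      (\<Sum>i\<in>I. \<Sum>j\<in>I. c i * cnj (c j) * (\<Sum>q\<in>N. 1 * (g q i * cnj (g q j))))"
    by (simp add: kernel right_diff_distrib sum_subtractf)
  also have "\<dots> = of_real ((\<Sum>p\<in>P. L (e p)) - (\<Sum>q\<in>N. L (g q)))"
    unfolding form by simp
  finally have "(\<Sum>k\<in>K. \<beta> k * L (u k)) = (\<Sum>p\<in>P. L (e p)) - (\<Sum>q\<in>N. L (g q))"
    by (simp only: of_real_eq_iff)
  moreover have "(\<Sum>q\<in>N. L (g q)) = 0"
    using c(2) by (auto simp: L_def V_def)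
  moreover have "(\<Sum>p\<in>P. L (e p)) \<ge> 0" by (auto simp: L_def intro!: sum_nonneg)
  ultimately have "(\<Sum>k\<in>K. - (\<beta> k * L (u k))) \<le> 0" by (simp add: sum_negf)
  moreover have nonneg: "- (\<beta> k * L (u k)) \<ge> 0" if "k \<in> K" for k
  proof (cases "\<beta> k > 0")
    case True
    then show ?thesis using c(2) that by (auto simp: L_def V_def)
  next
    case False
    then show ?thesis by (auto simp: L_def mult_nonpos_nonneg)
  qed
  ultimately have "(\<Sum>k\<in>K. - (\<beta> k * L (u k))) = 0"
    by (intro antisym sum_nonneg) auto
  then have "- (\<beta> k * L (u k)) = 0" if "k \<in> K" for k
    using sum_nonneg_eq_0_iff[of K "\<lambda>k. - (\<beta> k * L (u k))"] \<open>finite K\<close> nonneg that by blast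
  then have "(\<Sum>i\<in>I. c i * u k i) = 0" if "k \<in> K" for k
    using nonzero[OF that] that by (auto simp: L_def)
  then show False using nondegenerate c(1) by blast
qed

section \<open>Positive kernels on the unit disk\<close>

lemma one_minus_mult_cnj_nonzero:
  assumes "norm a \<le> 1" "norm w < 1"
  shows "1 - cnj a * w \<noteq> 0"
proof
  assume "1 - cnj a * w = 0"
  then have "norm (cnj a * w) = 1" by (simp add: algebra_simps)
  moreover have "norm a * norm w \<le> 1 * norm w" by (intro mult_right_mono) (use assms in auto)
  ultimately show False using assms by (simp add: norm_mult)
qed

text \<open>The function \<open>k\<close> is the normalized Szego kernel at \<open>a\<close>. The
  square root divides the factor \<open>1 - a * cnj a\<close> evenly between both arguments, so that
  the Pick kernel of a single factor is exactly one square.\<close>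

lemma Blaschke_factor_kernel:
  assumes "norm a < 1" "norm w < 1" "norm v < 1"
  defines "b \<equiv> \<lambda>w. (w - a) / (1 - cnj a * w)"
    and "k \<equiv> \<lambda>w. of_real (sqrt (1 - (norm a)\<^sup>2)) / (1 - cnj a * w)"
  shows "1 - b w * cnj (b v) = (1 - w * cnj v) * (k w * cnj (k v))"
proof -
  have ne: "1 - cnj a * w \<noteq> 0" "1 - a * cnj v \<noteq> 0"
    using one_minus_mult_cnj_nonzero[of a w] one_minus_mult_cnj_nonzero[of a v] assms
    by (auto dest: arg_cong[of _ _ cnj])
  have "(norm a)\<^sup>2 \<le> 1" using assms by (simp add: power_le_one)
  then have "complex_of_real (sqrt (1 - (norm a)\<^sup>2)) * of_real (sqrt (1 - (norm a)\<^sup>2)) = 1 - a * cnj a"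
    unfolding of_real_mult[symmetric] by (simp add: complex_norm_square[symmetric])
  then have k: "k w * cnj (k v) = (1 - a * cnj a) / ((1 - cnj a * w) * (1 - a * cnj v))"
    by (simp add: k_def)
  have "1 - b w * cnj (b v) =
      ((1 - cnj a * w) * (1 - a * cnj v) - (w - a) * (cnj v - cnj a)) / ((1 - cnj a * w) * (1 - a * cnj v))"
    using ne by (simp add: b_def diff_divide_eq_iff divide_simps)
  also have "(1 - cnj a * w) * (1 - a * cnj v) - (w - a) * (cnj v - cnj a) =
      (1 - w * cnj v) * (1 - a * cnj a)"
    by (simp add: algebra_simps)
  finally show ?thesis by (simp add: k)
qed

lemma finite_Blaschke_kernel:
  assumes "finite_Blaschke d B"
  shows "\<exists>e. \<forall>w\<in>ball 0 1. \<forall>v\<in>ball 0 1.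
    1 - B w * cnj (B v) = (1 - w * cnj v) * (\<Sum>j=1..d. e j w * cnj (e j v))"
proof -
  obtain c a where c: "norm c = 1" and a: "\<forall>k\<in>{1..d}. norm (a k) < 1"
    and B: "\<And>z. z \<in> ball 0 1 \<Longrightarrow> B z = c * (\<Prod>k=1..d. (z - a k) / (1 - cnj (a k) * z))"
    using assms unfolding finite_Blaschke_def by blast
  define b where "b = (\<lambda>k z. (z - a k) / (1 - cnj (a k) * z))"
  have "\<exists>e. \<forall>w\<in>ball 0 1. \<forall>v\<in>ball 0 1. 1 - (\<Prod>k=1..d. b k w) * cnj (\<Prod>k=1..d. b k v) =
      (1 - w * cnj v) * (\<Sum>j=1..d. e j w * cnj (e j v))"
    using a
  proof (induction d)
    case 0
    then show ?case by simp
  next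
    case (Suc d)
    have "\<forall>k\<in>{1..d}. norm (a k) < 1" using Suc.prems by simp
    from Suc.IH[OF this]
    obtain e where e: "\<And>w v. w \<in> ball 0 1 \<Longrightarrow> v \<in> ball 0 1 \<Longrightarrow>
        1 - (\<Prod>k=1..d. b k w) * cnj (\<Prod>k=1..d. b k v) =
        (1 - w * cnj v) * (\<Sum>j=1..d. e j w * cnj (e j v))" by blast
    define k where "k = (\<lambda>w. of_real (sqrt (1 - (norm (a (Suc d)))\<^sup>2)) / (1 - cnj (a (Suc d)) * w))"
    define e' where "e' = e(Suc d := \<lambda>w. (\<Prod>k=1..d. b k w) * k w)"
    show ?case
    proof (intro exI[of _ e'] ballI)
      fix w v :: complex assume wv: "w \<in> ball 0 1" "v \<in> ball 0 1"
      define p q where "p = (\<Prod>k=1..d. b k w)" and "q = (\<Prod>k=1..d. b k v)"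
      have "(\<Sum>j=1..d. e' j w * cnj (e' j v)) = (\<Sum>j=1..d. e j w * cnj (e j v))"
        by (intro sum.cong) (auto simp: e'_def)
      then have sum_e': "(\<Sum>j=1..Suc d. e' j w * cnj (e' j v)) =
          (\<Sum>j=1..d. e j w * cnj (e j v)) + (p * cnj q) * (k w * cnj (k v))"
        by (simp add: e'_def p_def q_def)
      have factor: "1 - b (Suc d) w * cnj (b (Suc d) v) = (1 - w * cnj v) * (k w * cnj (k v))"
        unfolding b_def k_def by (rule Blaschke_factor_kernel) (use Suc.prems wv in auto)
      have "1 - (\<Prod>k=1..Suc d. b k w) * cnj (\<Prod>k=1..Suc d. b k v) =
          (1 - p * cnj q) + (p * cnj q) * (1 - b (Suc d) w * cnj (b (Suc d) v))"
        by (simp add: p_def q_def algebra_simps)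
      also have "\<dots> = (1 - w * cnj v) * (\<Sum>j=1..Suc d. e' j w * cnj (e' j v))"
        unfolding factor sum_e' using e[OF wv] by (simp add: p_def q_def algebra_simps)
      finally show "1 - (\<Prod>k=1..Suc d. b k w) * cnj (\<Prod>k=1..Suc d. b k v) =
          (1 - w * cnj v) * (\<Sum>j=1..Suc d. e' j w * cnj (e' j v))" .
    qed
  qed
  moreover have "B w * cnj (B v) = (\<Prod>k=1..d. b k w) * cnj (\<Prod>k=1..d. b k v)"
    if "w \<in> ball 0 1" "v \<in> ball 0 1" for w v
  proof -
    \<comment> \<open>The unimodular constant cancels against its conjugate.\<close>
    have "B w * cnj (B v) = (c * cnj c) * ((\<Prod>k=1..d. b k w) * cnj (\<Prod>k=1..d. b k v))"
      using B that by (simp add: b_def)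
    also have "c * cnj c = 1"
      using c by (simp add: complex_norm_square[symmetric])
    finally show ?thesis by simp
  qed
  ultimately show ?thesis by auto
qed

text \<open>An additional zero at the origin contributes the factor z. This is the source of the 1
  in \<open>d1 + 1\<close>.\<close>

lemma finite_Blaschke_times_id:
  assumes "finite_Blaschke d B"
  shows "finite_Blaschke (Suc d) (\<lambda>w. w * B w)"
proof -
  obtain c a where c: "norm c = 1" and a: "\<forall>k\<in>{1..d}. norm (a k) < 1"
    and B: "\<forall>z\<in>ball 0 1. B z = c * (\<Prod>k=1..d. (z - a k) / (1 - cnj (a k) * z))"
    using assms unfolding finite_Blaschke_def by blast
  define a' where "a' = a(Suc d := 0)"
  have "(\<Prod>k=1..d. (z - a' k) / (1 - cnj (a' k) * z)) =
      (\<Prod>k=1..d. (z - a k) / (1 - cnj (a k) * z))" for z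
    by (intro prod.cong) (auto simp: a'_def)
  then have "\<forall>z\<in>ball 0 1. z * B z = c * (\<Prod>k=1..Suc d. (z - a' k) / (1 - cnj (a' k) * z))"
    using B by (simp add: a'_def)
  moreover have "\<forall>k\<in>{1..Suc d}. norm (a' k) < 1"
    using a by (auto simp: a'_def)
  ultimately show ?thesis unfolding finite_Blaschke_def using c by blast
qed

text \<open>The representation of f''/f' is assumed only where \<open>B2\<close> is nonzero;
  finiteness of the zeros leaves infinitely many points to choose from.\<close>

lemma finite_Blaschke_zeros:
  assumes "finite_Blaschke d B"
  shows "finite {w \<in> ball 0 1. B w = 0}"
proof -
  obtain c a where c: "norm c = 1" and a: "\<forall>k\<in>{1..d}. norm (a k) < 1"
    and B: "\<forall>z\<in>ball 0 1. B z = c * (\<Prod>k=1..d. (z - a k) / (1 - cnj (a k) * z))"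
    using assms unfolding finite_Blaschke_def by blast
  have "{w \<in> ball 0 1. B w = 0} \<subseteq> a ` {1..d}"
  proof
    fix w assume "w \<in> {w \<in> ball 0 1. B w = 0}"
    then have w: "norm w < 1" "c * (\<Prod>k=1..d. (w - a k) / (1 - cnj (a k) * w)) = 0"
      using B by auto
    then obtain k where k: "k \<in> {1..d}" "(w - a k) / (1 - cnj (a k) * w) = 0"
      using c by auto
    moreover have "1 - cnj (a k) * w \<noteq> 0"
      using one_minus_mult_cnj_nonzero[of "a k" w] a k(1) w(1) by (simp add: less_imp_le)
    ultimately show "w \<in> a ` {1..d}" by auto
  qed
  then show ?thesis by (rule finite_subset) simp
qed

text \<open>On the circle \<open>\<zeta> * cnj \<zeta> = 1\<close>, so \<open>u w\<close> is
  \<open>1 / (1 - cnj \<zeta> * w)\<close>, the Szego kernel at a boundary point. Hence each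
  pre-vertex contributes a single square, weighted by its \<beta>.\<close>

lemma Herglotz_kernel:
  assumes "norm \<zeta> = 1" "norm w < 1" "norm v < 1"
  defines "u \<equiv> \<lambda>w. \<zeta> / (\<zeta> - w)"
  shows "u w + cnj (u v) - 1 = (1 - w * cnj v) * (u w * cnj (u v))"
proof -
  have unit: "\<zeta> * cnj \<zeta> = 1"
    using assms by (simp add: complex_norm_square[symmetric])
  have ne: "\<zeta> - w \<noteq> 0" "\<zeta> - v \<noteq> 0" using assms by auto
  then have ne': "cnj \<zeta> - cnj v \<noteq> 0" by (metis complex_cnj_diff complex_cnj_zero_iff)
  have num: "\<zeta> * (cnj \<zeta> - cnj v) + cnj \<zeta> * (\<zeta> - w) - (\<zeta> - w) * (cnj \<zeta> - cnj v) =
      (1 - w * cnj v) * (\<zeta> * cnj \<zeta>)"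
    using unit by (simp add: algebra_simps)
  have "u w + cnj (u v) - 1 =
      (\<zeta> * (cnj \<zeta> - cnj v) + cnj \<zeta> * (\<zeta> - w) - (\<zeta> - w) * (cnj \<zeta> - cnj v)) /
      ((\<zeta> - w) * (cnj \<zeta> - cnj v))"
    using ne ne' by (simp add: u_def add_divide_distrib diff_divide_distrib)
  then show ?thesis unfolding num by (simp add: u_def)
qed

section \<open>Counting convex and concave vertices\<close>

theorem theorem2:
  fixes f B1 B2 :: "complex \<Rightarrow> complex" and n d1 d2 :: nat
    and z :: "nat \<Rightarrow> complex" and \<alpha> \<beta> :: "nat \<Rightarrow> real"
  assumes polygon: "polygon_map f n z \<alpha>"
    and exterior: "\<And>k. k \<in> {1..n+1} \<Longrightarrow> 2 * pi * \<beta> k = pi - \<alpha> k"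
    and sum_exterior: "(\<Sum>k=1..n+1. \<beta> k) = 1"
    and Schwarz_Christoffel: "\<And>w. w \<in> ball 0 1 \<Longrightarrow>
      deriv (deriv f) w / deriv f w = - 2 * (\<Sum>k=1..n+1. of_real (\<beta> k) / (w - z k))"
    and B1: "finite_Blaschke d1 B1" and B2: "finite_Blaschke d2 B2"
    and no_common_zeros: "\<not> (\<exists>w\<in>ball 0 1. B1 w = 0 \<and> B2 w = 0)"
    and degrees: "d1 + d2 = n"
    and representation: "\<And>w. w \<in> ball 0 1 \<Longrightarrow> B2 w \<noteq> 0 \<Longrightarrow>
      deriv (deriv f) w / deriv f w = (2 * (B1 w / B2 w)) / (1 - w * (B1 w / B2 w))"
  shows "d2 = card {k \<in> {1..n+1}. \<beta> k < 0} \<and> d1 + 1 = card {k \<in> {1..n+1}. \<beta> k > 0}"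
proof -
  define K where "K = {1..n+1}"
  have K: "finite K" "card K = n + 1" "inj_on z K"
    using polygon by (auto simp: K_def polygon_map_def)
  have "z ` K = {\<zeta> \<in> sphere 0 1. \<not> interior_angle f \<zeta> pi}"
    using polygon by (simp add: K_def polygon_map_def)
  then have z: "norm (z k) = 1" "\<not> interior_angle f (z k) pi" if "k \<in> K" for k
    using that by (auto simp: set_eq_iff image_iff)
  have z_ne: "z k \<noteq> w" if "k \<in> K" "w \<in> ball 0 1" for k w
    using z(1)[OF that(1)] that(2) by auto
  \<comment> \<open>A zero exterior angle means interior angle \<open>pi\<close>, which
    \<open>polygon_map\<close> excludes at pre-vertices.\<close>
  have \<beta>: "\<beta> k \<noteq> 0" if "k \<in> K" for k
  proof
    assume "\<beta> k = 0"
    then have "\<alpha> k = pi" using exterior[of k] that by (simp add: K_def)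
    moreover have "interior_angle f (z k) (\<alpha> k)"
      using polygon that by (simp add: K_def polygon_map_def)
    ultimately show False using z(2)[OF that] by simp
  qed

  define u where "u = (\<lambda>k w. z k / (z k - w))"
  define G where "G = (\<lambda>w. \<Sum>k\<in>K. of_real (\<beta> k) * u k w)"
  define D where "D = (\<lambda>w. B2 w - w * B1 w)"
  have sum\<beta>: "(\<Sum>k\<in>K. complex_of_real (\<beta> k)) = 1"
    using sum_exterior by (simp add: K_def flip: of_real_sum)
  have G_eq: "G w = 1 + w * (deriv (deriv f) w / deriv f w) / 2" if w: "w \<in> ball 0 1" for w
  proof -
    \<comment> \<open>In this form the constants add up to 1 because the \<beta> do, and the
      remaining fractions form the Schwarz-Christoffel sum.\<close>
    have "u k w = 1 - w / (w - z k)" if "k \<in> K" for k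
      using z_ne[OF that w] by (simp add: u_def field_simps)
    then have "G w = (\<Sum>k\<in>K. of_real (\<beta> k) * (1 - w / (w - z k)))"
      by (simp add: G_def)
    also have "\<dots> = (\<Sum>k\<in>K. of_real (\<beta> k)) - w * (\<Sum>k\<in>K. of_real (\<beta> k) / (w - z k))"
      by (simp add: right_diff_distrib sum_subtractf sum_distrib_left mult_ac)
    finally show ?thesis
      unfolding Schwarz_Christoffel[OF w] sum\<beta> K_def[symmetric] by simp
  qed

  define S where "S = {w \<in> ball 0 1. B2 w \<noteq> 0 \<and> D w \<noteq> 0}"
  \<comment> \<open>Otherwise \<open>D\<close> would vanish off a finite set, so f''/f' would be
    zero at \<open>n + 1\<close> points; the Cauchy lemma would then force every \<beta> to be
    zero.\<close>
  have "infinite S"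
  proof
    assume "finite S"
    define T where "T = ball (0::complex) 1 - (S \<union> {w \<in> ball 0 1. B2 w = 0})"
    have "open (ball (0::complex) 1)" "ball (0::complex) 1 \<noteq> {}" by auto
    then have "infinite (ball (0::complex) 1)" using finite_imp_not_open by blast
    then have "infinite T"
      unfolding T_def using \<open>finite S\<close> finite_Blaschke_zeros[OF B2] by (intro Diff_infinite_finite) auto
    then obtain Y where Y: "Y \<subseteq> T" "finite Y" "card Y = n + 1"
      using infinite_arbitrarily_large by metis
    have "(\<Sum>k\<in>K. of_real (\<beta> k) / (z k - w)) = 0" if "w \<in> Y" for w
    proof -
      have w: "w \<in> ball 0 1" "B2 w \<noteq> 0" "B2 w = w * B1 w"
        using that Y(1) by (auto simp: T_def S_def D_def)
      \<comment> \<open>Here the denominator in the representation vanishes, and division by zero gives zero.\<close>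
      have "deriv (deriv f) w / deriv f w = 0"
        unfolding representation[OF w(1,2)] using w(2,3) by simp
      then have "(\<Sum>k\<in>K. of_real (\<beta> k) / (w - z k)) = 0"
        using Schwarz_Christoffel[OF w(1)] unfolding K_def[symmetric] by simp
      moreover have "(\<Sum>k\<in>K. of_real (\<beta> k) / (z k - w)) = - (\<Sum>k\<in>K. of_real (\<beta> k) / (w - z k))"
        unfolding sum_negf[symmetric] by (intro sum.cong) (auto simp: minus_divide_right)
      ultimately show ?thesis by simp
    qed
    moreover have "Y \<inter> z ` K = {}" using Y(1) z_ne unfolding T_def by blast
    moreover have "1 \<in> K" by (simp add: K_def)
    ultimately have "complex_of_real (\<beta> 1) = 0"
      using cauchy_matrix_nondegenerate[of K z Y "\<lambda>k. of_real (\<beta> k)" 1] K Y by simp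
    then show False using \<beta>[OF \<open>1 \<in> K\<close>] by simp
  qed
  then obtain W where W: "W \<subseteq> S" "finite W" "card W = n + 1"
    using infinite_arbitrarily_large by metis
  have G_D: "D w * G w = B2 w" if "w \<in> S" for w
  proof -
    have w: "w \<in> ball 0 1" "B2 w \<noteq> 0" "D w \<noteq> 0" using that by (auto simp: S_def)
    have "1 - w * (B1 w / B2 w) = D w / B2 w" using w by (simp add: D_def diff_divide_distrib)
    then have "deriv (deriv f) w / deriv f w = 2 * B1 w / D w"
      unfolding representation[OF w(1,2)] using w by simp
    then have "G w = 1 + w * B1 w / D w" using G_eq[OF w(1)] by simp
    then show ?thesis using w by (simp add: D_def field_simps)
  qed

  obtain e where e: "\<And>w v. w \<in> ball 0 1 \<Longrightarrow> v \<in> ball 0 1 \<Longrightarrow>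
      1 - w * B1 w * cnj (v * B1 v) = (1 - w * cnj v) * (\<Sum>j=1..Suc d1. e j w * cnj (e j v))"
    using finite_Blaschke_kernel[OF finite_Blaschke_times_id[OF B1]] by blast
  obtain g where g: "\<And>w v. w \<in> ball 0 1 \<Longrightarrow> v \<in> ball 0 1 \<Longrightarrow>
      1 - B2 w * cnj (B2 v) = (1 - w * cnj v) * (\<Sum>j=1..d2. g j w * cnj (g j v))"
    using finite_Blaschke_kernel[OF B2] by blast

  \<comment> \<open>Scaling by \<open>D\<close> is a diagonal congruence: the weights \<beta> stay
    the same, and since \<open>D\<close> has no zero on \<open>S\<close>, nondegeneracy is
    kept.\<close>
  define U where "U = (\<lambda>k w. D w * u k w)"
  have kernel: "(\<Sum>k\<in>K. of_real (\<beta> k) * (U k w * cnj (U k v))) =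
      (\<Sum>j=1..Suc d1. e j w * cnj (e j v)) - (\<Sum>j=1..d2. g j w * cnj (g j v))"
    if "w \<in> W" "v \<in> W" for w v
  proof -
    have S: "w \<in> S" "v \<in> S" and b: "w \<in> ball 0 1" "v \<in> ball 0 1"
      using that W(1) by (auto simp: S_def)
    have ne: "1 - w * cnj v \<noteq> 0"
      using one_minus_mult_cnj_nonzero[of v w] b by (simp add: mult.commute)
    have Hk: "u k w + cnj (u k v) - 1 = (1 - w * cnj v) * (u k w * cnj (u k v))" if "k \<in> K" for k
      unfolding u_def by (rule Herglotz_kernel) (use z(1)[OF that] b in auto)
    have "(1 - w * cnj v) * (\<Sum>k\<in>K. of_real (\<beta> k) * (u k w * cnj (u k v))) =
        (\<Sum>k\<in>K. of_real (\<beta> k) * ((1 - w * cnj v) * (u k w * cnj (u k v))))"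
      by (simp add: sum_distrib_left mult_ac)
    also have "\<dots> = (\<Sum>k\<in>K. of_real (\<beta> k) * (u k w + cnj (u k v) - 1))"
      by (intro sum.cong refl) (simp only: Hk)
    also have "\<dots> = G w + cnj (G v) - 1"
      using sum\<beta> by (simp add: G_def algebra_simps sum.distrib sum_subtractf)
    finally have H: "(1 - w * cnj v) * (\<Sum>k\<in>K. of_real (\<beta> k) * (u k w * cnj (u k v))) =
        G w + cnj (G v) - 1" .
    have "(1 - w * cnj v) * (\<Sum>k\<in>K. of_real (\<beta> k) * (U k w * cnj (U k v))) =
        D w * cnj (D v) * ((1 - w * cnj v) * (\<Sum>k\<in>K. of_real (\<beta> k) * (u k w * cnj (u k v))))"
      by (simp add: U_def sum_distrib_left mult_ac)
    also have "\<dots> = (D w * G w) * cnj (D v) + D w * cnj (D v * G v) - D w * cnj (D v)"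
      unfolding H by (simp add: algebra_simps)
    \<comment> \<open>With B = \<open>B2\<close>, this is BD* + DB* - DD* = BB* - (B - D)(B - D)*,
      the starred factors being conjugates taken at \<open>v\<close>; and B - D is
      \<open>w * B1 w\<close>.\<close>
    also have "\<dots> = (1 - w * B1 w * cnj (v * B1 v)) - (1 - B2 w * cnj (B2 v))"
      unfolding G_D[OF S(1)] G_D[OF S(2)] by (simp add: D_def algebra_simps)
    also have "\<dots> = (1 - w * cnj v) *
        ((\<Sum>j=1..Suc d1. e j w * cnj (e j v)) - (\<Sum>j=1..d2. g j w * cnj (g j v)))"
      unfolding e[OF b] g[OF b] by (simp only: right_diff_distrib)
    finally show ?thesis using ne by (rule mult_left_cancel[THEN iffD1, rotated])
  qed
  \<comment> \<open>The Cauchy matrix is used transposed: the sample points in \<open>W\<close> are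
    the nodes and the pre-vertices the evaluation points. There are \<open>n + 1\<close> of
    each.\<close>
  have nondegenerate: "\<forall>w\<in>W. c w = 0" if c: "\<And>k. k \<in> K \<Longrightarrow> (\<Sum>w\<in>W. c w * U k w) = 0" for c
  proof
    fix w assume "w \<in> W"
    have "(\<Sum>w\<in>W. c w * D w / (w - y)) = 0" if "y \<in> z ` K" for y
    proof -
      obtain k where k: "k \<in> K" "y = z k" using \<open>y \<in> z ` K\<close> by blast
      have "c w * U k w = - z k * (c w * D w / (w - z k))" for w
        unfolding U_def u_def by (metis (no_types, opaque_lifting) minus_diff_eq minus_divide_right
            mult.assoc mult.commute mult_minus_left times_divide_eq_left times_divide_eq_right)
      then have "- z k * (\<Sum>w\<in>W. c w * D w / (w - z k)) = 0"
        using c[OF k(1)] by (simp add: sum_distrib_left)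
      moreover have "z k \<noteq> 0" using z(1)[OF k(1)] by auto
      ultimately show ?thesis by (simp add: k)
    qed
    moreover have "z ` K \<inter> W = {}" using W(1) z_ne unfolding S_def by blast
    moreover have "card W \<le> card (z ` K)" using K W by (simp add: card_image)
    ultimately have "c w * D w = 0"
      using cauchy_matrix_nondegenerate[of W "\<lambda>w. w" "z ` K" "\<lambda>w. c w * D w" w] \<open>w \<in> W\<close> K W
      by simp
    then show "c w = 0" using \<open>w \<in> W\<close> W(1) by (auto simp: S_def)
  qed

  have "card W \<le> card {k\<in>K. \<beta> k > 0} + card {1..d2}"
    by (rule inertia_bound[where u=U and P="{1..Suc d1}" and e=e and g=g])
      (fact W K \<beta> nondegenerate kernel finite_atLeastAtMost)+
  then have pos: "n + 1 \<le> card {k\<in>K. \<beta> k > 0} + d2" using W(3) by simp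
  \<comment> \<open>Negating the weights exchanges the two groups of squares, so the same one-sided
    bound now counts the concave vertices.\<close>
  have kernel': "(\<Sum>k\<in>K. of_real (- \<beta> k) * (U k w * cnj (U k v))) =
      (\<Sum>j=1..d2. g j w * cnj (g j v)) - (\<Sum>j=1..Suc d1. e j w * cnj (e j v))"
    if "w \<in> W" "v \<in> W" for w v
  proof -
    have "(\<Sum>k\<in>K. of_real (- \<beta> k) * (U k w * cnj (U k v))) =
        - (\<Sum>k\<in>K. of_real (\<beta> k) * (U k w * cnj (U k v)))"
      by (simp add: sum_negf)
    then show ?thesis unfolding kernel[OF that] by simp
  qed
  have \<beta>': "- \<beta> k \<noteq> 0" if "k \<in> K" for k using \<beta>[OF that] by simp
  have "card W \<le> card {k\<in>K. - \<beta> k > 0} + card {1..Suc d1}"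
    by (rule inertia_bound[where u=U and P="{1..d2}" and e=g and g=e])
      (fact W K \<beta>' nondegenerate kernel' finite_atLeastAtMost)+
  then have neg: "n + 1 \<le> card {k\<in>K. \<beta> k < 0} + Suc d1" using W(3) by simp
  \<comment> \<open>The lower bounds \<open>d1 + 1\<close> and \<open>d2\<close> add up to
    \<open>n + 1\<close>, the number of all vertices, so both are attained.\<close>
  have "K = {k\<in>K. \<beta> k > 0} \<union> {k\<in>K. \<beta> k < 0}" using \<beta> by force
  moreover have "card ({k\<in>K. \<beta> k > 0} \<union> {k\<in>K. \<beta> k < 0}) =
      card {k\<in>K. \<beta> k > 0} + card {k\<in>K. \<beta> k < 0}"
    using K(1) by (intro card_Un_disjoint) auto
  ultimately have "card {k\<in>K. \<beta> k > 0} + card {k\<in>K. \<beta> k < 0} = n + 1"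
    using K(2) by simp
  then show ?thesis using pos neg degrees unfolding K_def by linarith
qed

end
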